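(* Let $A$ be a densely defined closed nonnegative symmetric operator in a separable Hilbert space $\mathfrak H$, let $\widetilde A_0$ be a nonnegative self-adjoint extension of $A$, and let $P_{-1}$ be the orthogonal projector from $\mathfrak H$ onto $\mathcal N_{-1}=\ker(A^*+I)$. Then $\widetilde A_0$ is the unique nonnegative self-adjoint extension of $A$ if and only if both of the following hold: $$\lim_{\varepsilon\downarrow 0}\bigl(P_{-1}(\widetilde A_0+1)(\widetilde A_0+\varepsilon)^{-1}\upharpoonright\mathcal N_{-1}\bigr)^{-1}=0,$$ $$\lim_{\varepsilon\downarrow 0}\bigl(P_{-1}(\widetilde A_0+1)(\varepsilon\widetilde A_0+I)^{-1}\upharpoonright\mathcal N_{-1}\bigr)^{-1}=0,$$ where the limits are strong limits of bounded operators in $\mathcal N_{-1}$.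
   Context: $\mathcal N_z=\ker(A^*-z)$ denotes the defect subspace of $A$ at $z$. For $0<\varepsilon<1$ the expressions $P_{-1}(\widetilde A_0+1)(\widetilde A_0+\varepsilon)^{-1}\upharpoonright\mathcal N_{-1}$ and $P_{-1}(\widetilde A_0+1)(\varepsilon\widetilde A_0+I)^{-1}\upharpoonright\mathcal N_{-1}$ are regarded as bounded operators in the Hilbert space $\mathcal N_{-1}$, and the outer inverse is the inverse in $\mathcal N_{-1}$. *)

theory Defs
  imports "HOL-Analysis.Analysis"
begin

text \<open>The inner product is linear in the first argument.\<close>

class complex_inner = real_normed_vector +
  fixes scaleC :: "complex \<Rightarrow> 'a \<Rightarrow> 'a"  (infixr \<open>*\<^sub>C\<close> 75)
    and cinner :: "'a \<Rightarrow> 'a \<Rightarrow> complex"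
  assumes scaleC_add_right: "c *\<^sub>C (x + y) = c *\<^sub>C x + c *\<^sub>C y"
    and scaleC_add_left: "(c + d) *\<^sub>C x = c *\<^sub>C x + d *\<^sub>C x"
    and scaleC_scaleC: "c *\<^sub>C d *\<^sub>C x = (c * d) *\<^sub>C x"
    and scaleR_scaleC: "r *\<^sub>R x = complex_of_real r *\<^sub>C x"
    and cinner_commute: "cinner x y = cnj (cinner y x)"
    and cinner_add_left: "cinner (x + y) z = cinner x z + cinner y z"
    and cinner_scaleC_left: "cinner (c *\<^sub>C x) y = c * cinner x y"
    and cinner_self: "cinner x x = complex_of_real ((norm x)\<^sup>2)"

class chilbert_space = complex_inner + complete_space

instantiation complex :: chilbert_space
begin

definition scaleC_complex :: "complex \<Rightarrow> complex \<Rightarrow> complex"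
  where "scaleC_complex c x = c * x"

definition cinner_complex :: "complex \<Rightarrow> complex \<Rightarrow> complex"
  where "cinner_complex x y = x * cnj y"

instance
  by standard
    (simp_all add: scaleC_complex_def cinner_complex_def algebra_simps scaleR_conv_of_real
      complex_norm_square[symmetric] flip: complex_norm_square)

end

text \<open>
  An operator is represented by its graph, the set of all pairs \<open>(x, T x)\<close> with \<open>x\<close> in the
  domain of \<open>T\<close>. Thus the domain is \<^const>\<open>Domain\<close>, equality of operators includes equality of
  domains, \<open>S \<subseteq> T\<close> says that \<open>T\<close> extends \<open>S\<close>, and \<^const>\<open>Id\<close> is the identity operator.
  The inverse is \<open>T\<inverse>\<close>; it is the graph of an operator exactly when \<open>T\<close> is injective.
\<close>

type_synonym 'a op = "('a \<times> 'a) set"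

definition linear_op :: "'a::complex_inner op \<Rightarrow> bool" where
  "linear_op T \<longleftrightarrow> single_valued T \<and> (0, 0) \<in> T \<and>
     (\<forall>x y x' y'. (x, y) \<in> T \<longrightarrow> (x', y') \<in> T \<longrightarrow> (x + x', y + y') \<in> T) \<and>
     (\<forall>c x y. (x, y) \<in> T \<longrightarrow> (c *\<^sub>C x, c *\<^sub>C y) \<in> T)"

definition op_add :: "'a::complex_inner op \<Rightarrow> 'a op \<Rightarrow> 'a op" where
  "op_add S T = {(x, y + z) | x y z. (x, y) \<in> S \<and> (x, z) \<in> T}"

definition op_scale :: "complex \<Rightarrow> 'a::complex_inner op \<Rightarrow> 'a op" where
  "op_scale c T = {(x, c *\<^sub>C y) | x y. (x, y) \<in> T}"

text \<open>Composition \<open>S T\<close> in operator order: \<open>T\<close> acts first.\<close>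

definition op_comp :: "'a op \<Rightarrow> 'a op \<Rightarrow> 'a op" where
  "op_comp S T = T O S"

definition op_restrict :: "'a op \<Rightarrow> 'a set \<Rightarrow> 'a op" where
  "op_restrict T M = {(x, y) \<in> T. x \<in> M}"

definition op_ker :: "'a::complex_inner op \<Rightarrow> 'a set" where
  "op_ker T = {x. (x, 0) \<in> T}"

definition op_apply :: "'a op \<Rightarrow> 'a \<Rightarrow> 'a" where
  "op_apply T x = (THE y. (x, y) \<in> T)"

definition densely_defined :: "'a::complex_inner op \<Rightarrow> bool" where
  "densely_defined T \<longleftrightarrow> closure (Domain T) = UNIV"

text \<open>The graph of the adjoint; single-valued when \<open>T\<close> is densely defined.\<close>

definition adjoint_op :: "'a::complex_inner op \<Rightarrow> 'a op" where
  "adjoint_op T = {(y, z). \<forall>(x, w) \<in> T. cinner w y = cinner x z}"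

definition symmetric_op :: "'a::complex_inner op \<Rightarrow> bool" where
  "symmetric_op T \<longleftrightarrow> linear_op T \<and> (\<forall>(x, y) \<in> T. \<forall>(x', y') \<in> T. cinner y x' = cinner x y')"

definition nonnegative_op :: "'a::complex_inner op \<Rightarrow> bool" where
  "nonnegative_op T \<longleftrightarrow> (\<forall>(x, y) \<in> T. cinner y x \<in> \<real>\<^sub>\<ge>\<^sub>0)"

definition selfadjoint_op :: "'a::complex_inner op \<Rightarrow> bool" where
  "selfadjoint_op T \<longleftrightarrow> linear_op T \<and> densely_defined T \<and> adjoint_op T = T"

definition nonneg_sa_extension :: "'a::complex_inner op \<Rightarrow> 'a op \<Rightarrow> bool" where
  "nonneg_sa_extension A B \<longleftrightarrow> selfadjoint_op B \<and> nonnegative_op B \<and> A \<subseteq> B"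

definition defect_subspace :: "'a::complex_inner op \<Rightarrow> complex \<Rightarrow> 'a set" where
  "defect_subspace A z = op_ker (op_add (adjoint_op A) (op_scale (- z) Id))"

definition orth_projector :: "'a::complex_inner set \<Rightarrow> 'a op" where
  "orth_projector M = {(x, y). y \<in> M \<and> (\<forall>z \<in> M. cinner (x - y) z = 0)}"

definition bounded_op_in :: "'a::complex_inner set \<Rightarrow> 'a op \<Rightarrow> bool" where
  "bounded_op_in N T \<longleftrightarrow> linear_op T \<and> Domain T = N \<and> Range T \<subseteq> N \<and>
     (\<exists>C. \<forall>(x, y) \<in> T. norm y \<le> C * norm x)"

text \<open>
  Strong convergence of bounded operators in \<open>N\<close>. Being (eventually) a bounded operator defined
  on all of \<open>N\<close> is part of the notion, so \<^const>\<open>op_apply\<close> is only used where it is meaningful.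
\<close>

definition strong_limit_in ::
    "'a::complex_inner set \<Rightarrow> ('b \<Rightarrow> 'a op) \<Rightarrow> 'a op \<Rightarrow> 'b filter \<Rightarrow> bool" where
  "strong_limit_in N T L F \<longleftrightarrow>
     bounded_op_in N L \<and> (\<forall>\<^sub>F t in F. bounded_op_in N (T t)) \<and>
     (\<forall>x \<in> N. ((\<lambda>t. op_apply (T t) x) \<longlongrightarrow> op_apply L x) F)"

definition zero_op_in :: "'a::complex_inner set \<Rightarrow> 'a op" where
  "zero_op_in N = N \<times> {0}"

end

theory Submission
  imports Defs
begin

text \<open>
  The map \<open>B \<mapsto> (B + I)\<inverse>\<close> turns the problem into one about bounded operators. The range \<open>M\<close> of
  \<open>A + I\<close> is a closed subspace with orthogonal complement \<open>N = ker (A* + I)\<close>, and the nonnegative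
  self-adjoint extensions of \<open>A\<close> correspond to the symmetric operators \<open>D\<close> with \<open>0 \<le> D \<le> I\<close> that agree
  with \<open>C = (A0 + I)\<inverse>\<close> on \<open>M\<close> (\<open>unique_extension_iff\<close>). Injectivity of \<open>D\<close>, needed to recover an
  operator, comes from the density of the domain of \<open>A\<close>.

  The two families in the criterion become symmetric in \<open>C\<close> and \<open>I - C\<close>: the operators
  \<open>(A0 + I) (A0 + \<epsilon>)\<inverse>\<close> and \<open>(A0 + I) (\<epsilon> A0 + I)\<inverse>\<close> are the inverses of \<open>T + \<epsilon> (I - T)\<close> for
  \<open>T = I - C\<close> and \<open>T = C\<close>. For a positive definite \<open>S\<close>, the inverse of the compression of \<open>S\<inverse>\<close> to
  \<open>N\<close> is the Schur complement, whose quadratic form at \<open>x \<in> N\<close> is the minimum of \<open>(S (x + m), x + m)\<close>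
  over \<open>m \<in> M\<close>. As \<open>\<epsilon>\<close> decreases to 0 these minima tend to the infimum of \<open>(T (x + m), x + m)\<close>, so
  the strong limit is zero exactly if this infimum is zero for all \<open>x \<in> N\<close>
  (\<open>compressed_inverse_limit_zero_iff\<close>). The infimum is the form of the shorted operator of \<open>T\<close>, the
  greatest positive operator below \<open>T\<close> that vanishes on \<open>M\<close>.

  It remains to see that \<open>C\<close> is the only operator \<open>D\<close> as above if and only if both infima vanish
  (\<open>unique_positive_contraction_iff\<close>). The form of \<open>D - C\<close> does not change when an element of \<open>M\<close> is
  added to the argument, and it lies between \<open>- (C x, x)\<close> and \<open>((I - C) x, x)\<close>; if the infima of
  these bounds vanish, \<open>D - C\<close> is zero. If the infimum \<open>q\<close> for \<open>T = C\<close>, say, is positive at some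
  \<open>x \<in> N\<close>, take a minimizing sequence \<open>z\<^sub>n\<close> in \<open>x + M\<close>. It is Cauchy for the form of \<open>T\<close>, hence
  \<open>T z\<^sub>n\<close> converges to some \<open>v\<close>; minimality puts \<open>v\<close> into \<open>N\<close> and gives \<open>(v, x) = q\<close>, and the
  Cauchy--Schwarz inequality gives \<open>\<bar>(y, v)\<bar>\<^sup>2 \<le> q (T y, y)\<close>. So the rank-one operator
  \<open>(\<cdot>, v) v / q\<close> can be subtracted from \<open>T\<close>, which yields another \<open>D\<close>.
\<close>

section \<open>Inner product and orthogonality\<close>

lemma scaleC_one [simp]: "1 *\<^sub>C x = (x::'a::complex_inner)"
  using scaleR_scaleC[of 1 x] by simp

lemma scaleC_neg_one [simp]: "(- 1) *\<^sub>C x = - (x::'a::complex_inner)"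
  using scaleR_scaleC[of "- 1" x] by simp

lemma scaleC_zero_right [simp]: "c *\<^sub>C (0::'a::complex_inner) = 0"
  using scaleC_add_right[of c "0::'a" 0] by simp

lemma scaleC_diff_right: "c *\<^sub>C (x - y) = c *\<^sub>C x - c *\<^sub>C (y::'a::complex_inner)"
  using scaleC_add_right[of c "x - y" y] by (simp add: algebra_simps)

lemma cinner_add_right: "cinner x (y + z) = cinner x y + cinner x (z::'a::complex_inner)"
  by (simp add: cinner_commute[of x] cinner_add_left)

lemma cinner_scaleC_right: "cinner x (c *\<^sub>C y) = cnj c * cinner x (y::'a::complex_inner)"
  by (simp add: cinner_commute[of x] cinner_scaleC_left)

lemma cinner_zero_left [simp]: "cinner 0 (y::'a::complex_inner) = 0"
  using cinner_add_left[of 0 0 y] by simp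

lemma cinner_zero_right [simp]: "cinner (y::'a::complex_inner) 0 = 0"
  using cinner_add_right[of y 0 0] by simp

lemma cinner_minus_left: "cinner (- x) (y::'a::complex_inner) = - cinner x y"
  using cinner_add_left[of x "- x" y] by (simp add: eq_neg_iff_add_eq_0 add.commute)

lemma cinner_minus_right: "cinner x (- y) = - cinner x (y::'a::complex_inner)"
  using cinner_add_right[of x y "- y"] by (simp add: eq_neg_iff_add_eq_0 add.commute)

lemma cinner_diff_left: "cinner (x - y) z = cinner x z - cinner y (z::'a::complex_inner)"
  by (metis cinner_add_left cinner_minus_left diff_conv_add_uminus)

lemma cinner_diff_right: "cinner x (y - z) = cinner x y - cinner x (z::'a::complex_inner)"
  by (metis cinner_add_right cinner_minus_right diff_conv_add_uminus)

lemma cinner_scaleR_left: "cinner (r *\<^sub>R x) (y::'a::complex_inner) = of_real r * cinner x y"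
  by (simp add: scaleR_scaleC cinner_scaleC_left)

lemma cinner_scaleR_right: "cinner x (r *\<^sub>R y) = of_real r * cinner x (y::'a::complex_inner)"
  by (simp add: scaleR_scaleC cinner_scaleC_right)

lemmas cinner_simps = cinner_add_left cinner_add_right cinner_diff_left cinner_diff_right
  cinner_minus_left cinner_minus_right cinner_scaleC_left cinner_scaleC_right
  cinner_scaleR_left cinner_scaleR_right

lemma Re_cinner_self: "Re (cinner x x) = (norm (x::'a::complex_inner))\<^sup>2"
  by (simp add: cinner_self)

lemma cinner_self_eq_0: "cinner x x = 0 \<longleftrightarrow> x = (0::'a::complex_inner)"
  by (simp add: cinner_self)

lemma cinner_ext: "(\<And>y. cinner x y = cinner x' y) \<Longrightarrow> x = (x'::'a::complex_inner)"
  using cinner_self_eq_0[of "x - x'"] by (simp add: cinner_diff_left)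

lemma Re_cinner_commute: "Re (cinner y x) = Re (cinner x (y::'a::complex_inner))"
  by (simp add: cinner_commute[of y x])

definition csubspace :: "'a::complex_inner set \<Rightarrow> bool" where
  "csubspace M \<longleftrightarrow> 0 \<in> M \<and> (\<forall>x\<in>M. \<forall>y\<in>M. x + y \<in> M) \<and> (\<forall>c. \<forall>x\<in>M. c *\<^sub>C x \<in> M)"

lemma csubspaceD:
  assumes "csubspace M"
  shows "0 \<in> M" "x \<in> M \<Longrightarrow> y \<in> M \<Longrightarrow> x + y \<in> M" "x \<in> M \<Longrightarrow> c *\<^sub>C x \<in> M"
    "x \<in> M \<Longrightarrow> r *\<^sub>R x \<in> M" "x \<in> M \<Longrightarrow> - x \<in> M" "x \<in> M \<Longrightarrow> y \<in> M \<Longrightarrow> x - y \<in> M"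
proof -
  show 1: "0 \<in> M" "x \<in> M \<Longrightarrow> y \<in> M \<Longrightarrow> x + y \<in> M" "x \<in> M \<Longrightarrow> c *\<^sub>C x \<in> M" for x y c
    using assms by (auto simp: csubspace_def)
  show "x \<in> M \<Longrightarrow> r *\<^sub>R x \<in> M"
    by (simp add: scaleR_scaleC 1)
  show 2: "x \<in> M \<Longrightarrow> - x \<in> M" for x
    using 1(3)[of x "- 1"] by simp
  show "x \<in> M \<Longrightarrow> y \<in> M \<Longrightarrow> x - y \<in> M"
    using 1(2)[of x "- y"] 2 by simp
qed

definition orth_compl :: "'a::complex_inner set \<Rightarrow> 'a set" where
  "orth_compl M = {x. \<forall>m\<in>M. cinner m x = 0}"

lemma orth_complD: "x \<in> orth_compl M \<Longrightarrow> m \<in> M \<Longrightarrow> cinner m x = 0"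
  by (simp add: orth_compl_def)

lemma orth_complD': "x \<in> orth_compl M \<Longrightarrow> m \<in> M \<Longrightarrow> cinner x m = 0"
  by (simp add: cinner_commute[of x m] orth_complD)

lemma orth_complI: "(\<And>m. m \<in> M \<Longrightarrow> cinner x m = 0) \<Longrightarrow> x \<in> orth_compl M"
  by (simp add: orth_compl_def cinner_commute[of _ x])

lemma csubspace_orth_compl: "csubspace (orth_compl M)"
  by (auto simp: csubspace_def orth_compl_def cinner_simps)

section \<open>Positive contractions and their quadratic forms\<close>

lemma discriminant_bound:
  fixes a b c :: real
  assumes "\<And>t. 0 \<le> a + 2 * t * b + t\<^sup>2 * c" "0 \<le> c"
  shows "b\<^sup>2 \<le> a * c"
proof (cases "c = 0")
  case True
  have "b = 0"
  proof (rule ccontr)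
    assume "b \<noteq> 0"
    \<comment> \<open>For this value of \<open>t\<close> the affine function \<open>a + 2 t b\<close> equals \<open>- 1\<close>.\<close>
    then show False
      using assms(1)[of "- (a + 1) / (2 * b)"] True by (simp add: field_simps)
  qed
  then show ?thesis using True by simp
next
  case False
  then have "c > 0" using assms(2) by simp
  then show ?thesis
    using assms(1)[of "- b / c"] by (simp add: field_simps power2_eq_square)
qed

definition quad :: "('a::complex_inner \<Rightarrow> 'a) \<Rightarrow> 'a \<Rightarrow> real" where
  "quad T x = Re (cinner (T x) x)"

text \<open>The symmetric operators \<open>T\<close> with \<open>0 \<le> T \<le> I\<close>. An everywhere defined symmetric map is
  linear, and the form bounds imply \<open>\<parallel>T\<parallel> \<le> 1\<close>.\<close>

locale positive_contraction =
  fixes T :: "'a::complex_inner \<Rightarrow> 'a"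
  assumes symm: "cinner (T x) y = cinner x (T y)"
    and nonneg: "0 \<le> quad T x"
    and le_norm: "quad T x \<le> (norm x)\<^sup>2"
begin

lemma T_add: "T (x + y) = T x + T y"
  by (rule cinner_ext) (simp add: symm cinner_simps)

lemma T_scaleC: "T (c *\<^sub>C x) = c *\<^sub>C T x"
  by (rule cinner_ext) (simp add: symm cinner_simps)

lemma T_scaleR: "T (r *\<^sub>R x) = r *\<^sub>R T x"
  by (simp add: scaleR_scaleC T_scaleC)

lemma T_diff: "T (x - y) = T x - T y"
  by (rule cinner_ext) (simp add: symm cinner_simps)

lemma T_zero: "T 0 = 0"
  using T_diff[of 0 0] by simp

lemma cinner_T_self: "cinner (T x) x = complex_of_real (quad T x)"
proof -
  have "cinner (T x) x = cnj (cinner (T x) x)"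
    using symm[of x x] cinner_commute[of "T x" x] by simp
  then have "Im (cinner (T x) x) = 0"
    by (metis Reals_cnj_iff complex_is_Real_iff)
  then show ?thesis by (simp add: quad_def complex_eq_iff)
qed

lemma quad_add_scaleR: "quad T (z + t *\<^sub>R m) = quad T z + 2 * t * Re (cinner (T z) m) + t\<^sup>2 * quad T m"
proof -
  have "Re (cinner (T m) z) = Re (cinner (T z) m)"
    using symm[of m z] Re_cinner_commute[of m "T z"] by simp
  then show ?thesis
    by (simp add: quad_def T_add T_scaleR cinner_simps power2_eq_square algebra_simps)
qed

lemma quad_scaleC: "quad T (c *\<^sub>C m) = (cmod c)\<^sup>2 * quad T m"
proof -
  have "cinner (T (c *\<^sub>C m)) (c *\<^sub>C m) = (c * cnj c) * cinner (T m) m"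
    by (simp add: T_scaleC cinner_simps)
  also have "c * cnj c = complex_of_real ((cmod c)\<^sup>2)"
    by (rule complex_norm_square[symmetric])
  finally show ?thesis
    by (simp add: quad_def del: of_real_power)
qed

lemma quad_parallelogram: "quad T (x - y) = 2 * quad T x + 2 * quad T y - quad T (x + y)"
  by (simp add: quad_def T_add T_diff cinner_simps)

text \<open>If moving from \<open>z\<close> along the complex line of \<open>m\<close> lowers the form by at most \<open>\<delta>\<close>, the
  derivative of the form at \<open>z\<close> in this direction is small: the discriminant of the quadratic
  polynomial \<open>t \<mapsto> quad T (z + t m) - quad T z + \<delta>\<close> cannot be positive. The choice
  \<open>\<delta> = quad T z\<close> is the Cauchy--Schwarz inequality.\<close>

lemma near_minimizer_bound:
  assumes "\<And>c. quad T z \<le> quad T (z + c *\<^sub>C m) + \<delta>"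
  shows "(cmod (cinner (T z) m))\<^sup>2 \<le> \<delta> * quad T m"
proof (cases "cinner (T z) m = 0")
  case True
  have "0 \<le> \<delta>" using assms[of 0] scaleR_scaleC[of 0 m] by simp
  then show ?thesis using True nonneg[of m] by simp
next
  case False
  \<comment> \<open>The phase \<open>c\<close> rotates \<open>m\<close> so that the derivative becomes real.\<close>
  define b c where "b = cinner (T z) m" and "c = sgn b"
  have b: "b \<noteq> 0" using False by (simp add: b_def)
  have "cnj b * b = cmod b * cmod b"
    by (metis complex_norm_square mult.commute power2_eq_square of_real_mult)
  then have c: "cnj c * b = cmod b" "cmod c = 1"
    using b by (simp_all add: c_def norm_sgn, simp add: sgn_eq)
  have "0 \<le> \<delta> + 2 * t * cmod b + t\<^sup>2 * quad T m" for t
  proof -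
    have "quad T z \<le> quad T (z + t *\<^sub>R (c *\<^sub>C m)) + \<delta>"
      using assms[of "of_real t * c"] by (simp add: scaleR_scaleC scaleC_scaleC)
    then show ?thesis
      unfolding quad_add_scaleR using c by (simp add: quad_scaleC cinner_simps flip: b_def)
  qed
  then show ?thesis
    using discriminant_bound[of \<delta> "cmod b" "quad T m"] nonneg[of m] by (simp add: b_def)
qed

lemma form_Cauchy_Schwarz: "(cmod (cinner (T z) m))\<^sup>2 \<le> quad T z * quad T m"
  by (rule near_minimizer_bound) (simp add: nonneg)

text \<open>This is \<open>T\<^sup>2 \<le> T\<close>. It turns convergence of forms into strong convergence.\<close>

lemma norm_T_le_quad: "(norm (T x))\<^sup>2 \<le> quad T x"
proof -
  have "((norm (T x))\<^sup>2)\<^sup>2 \<le> quad T x * quad T (T x)"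
    using form_Cauchy_Schwarz[of x "T x"] by (simp add: cinner_self norm_power)
  also have "\<dots> \<le> quad T x * (norm (T x))\<^sup>2"
    by (intro mult_left_mono le_norm nonneg)
  finally show ?thesis
    using nonneg[of x] by (cases "T x = 0") (simp_all add: power2_eq_square)
qed

end

lemma positive_contraction_id: "positive_contraction (\<lambda>x. x)"
  by standard (simp_all add: quad_def Re_cinner_self)

lemma cinner_Cauchy_Schwarz: "cmod (cinner x y) \<le> norm x * norm (y::'a::complex_inner)"
proof -
  have "(cmod (cinner x y))\<^sup>2 \<le> (norm x * norm y)\<^sup>2"
    using positive_contraction.form_Cauchy_Schwarz[OF positive_contraction_id, of x y]
    by (simp add: quad_def Re_cinner_self power_mult_distrib)
  then show ?thesis by (rule power2_le_imp_le) simp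
qed

lemma bounded_bilinear_cinner:
  "bounded_bilinear (cinner :: 'a::complex_inner \<Rightarrow> 'a \<Rightarrow> complex)"
  by standard (auto simp: cinner_simps scaleR_conv_of_real intro!: exI[of _ 1] cinner_Cauchy_Schwarz)

lemmas tendsto_cinner = bounded_bilinear.tendsto[OF bounded_bilinear_cinner]

lemma quad_complement: "quad (\<lambda>x. x - T x) x = (norm x)\<^sup>2 - quad T x"
  by (simp add: quad_def cinner_simps Re_cinner_self)

lemma positive_contraction_complement:
  assumes "positive_contraction T"
  shows "positive_contraction (\<lambda>x. x - T x)"
proof -
  interpret positive_contraction T by fact
  show ?thesis
    using nonneg le_norm by unfold_locales (simp_all add: cinner_simps symm quad_complement)
qed

text \<open>The convex combination \<open>(1 - \<epsilon>) T + \<epsilon> I\<close>, which is positive definite for \<open>0 < \<epsilon> \<le> 1\<close>.\<close>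

definition blend :: "('a::complex_inner \<Rightarrow> 'a) \<Rightarrow> real \<Rightarrow> 'a \<Rightarrow> 'a" where
  "blend T \<epsilon> x = T x + \<epsilon> *\<^sub>R (x - T x)"

lemma quad_blend: "quad (blend T \<epsilon>) x = quad T x + \<epsilon> * ((norm x)\<^sup>2 - quad T x)"
  by (simp add: quad_def blend_def cinner_simps Re_cinner_self)

lemma positive_contraction_blend:
  assumes "positive_contraction T" "0 \<le> \<epsilon>" "\<epsilon> \<le> 1"
  shows "positive_contraction (blend T \<epsilon>)"
proof -
  interpret positive_contraction T by fact
  show ?thesis
  proof
    show "cinner (blend T \<epsilon> x) y = cinner x (blend T \<epsilon> y)" for x y
      by (simp add: blend_def cinner_simps symm)
    fix x
    have "0 \<le> \<epsilon> * ((norm x)\<^sup>2 - quad T x)"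
      using assms le_norm[of x] by simp
    then show "0 \<le> quad (blend T \<epsilon>) x"
      unfolding quad_blend using nonneg[of x] by linarith
    have "\<epsilon> * ((norm x)\<^sup>2 - quad T x) \<le> 1 * ((norm x)\<^sup>2 - quad T x)"
      using assms le_norm[of x] by (intro mult_right_mono) auto
    then show "quad (blend T \<epsilon>) x \<le> (norm x)\<^sup>2"
      unfolding quad_blend by simp
  qed
qed

section \<open>Minimizing a form over an affine subspace\<close>

lemma Cauchy_of_square_bound:
  fixes s :: "nat \<Rightarrow> 'a::real_normed_vector"
  assumes "\<And>n k. n \<le> k \<Longrightarrow> (norm (s n - s k))\<^sup>2 \<le> K / Suc n"
  shows "Cauchy s"
proof (rule metric_CauchyI)
  fix e :: real assume "0 < e"
  have "(\<lambda>n. K / Suc n) \<longlonglongrightarrow> 0"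
    by (rule LIMSEQ_Suc[OF lim_const_over_n])
  then have "\<forall>\<^sub>F n in sequentially. K / Suc n < e\<^sup>2"
    using \<open>0 < e\<close> by (intro order_tendstoD) auto
  then obtain n0 where n0: "\<And>n. n \<ge> n0 \<Longrightarrow> K / Suc n < e\<^sup>2"
    by (auto simp: eventually_sequentially)
  have *: "dist (s n) (s k) < e" if "n0 \<le> n" "n \<le> k" for n k
  proof -
    have "(norm (s n - s k))\<^sup>2 < e\<^sup>2"
      using assms[of n k] n0[of n] that by linarith
    then show ?thesis
      unfolding dist_norm using \<open>0 < e\<close> by (simp add: power2_less_imp_less)
  qed
  show "\<exists>M. \<forall>m\<ge>M. \<forall>n\<ge>M. dist (s m) (s n) < e"
    by (metis * dist_commute nle_le)
qed

lemma tendsto_zero_of_square_bound: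
  fixes s :: "nat \<Rightarrow> 'a::real_normed_vector"
  assumes "\<And>n. (norm (s n))\<^sup>2 \<le> K / Suc n"
  shows "s \<longlonglongrightarrow> 0"
proof -
  have "(\<lambda>n. (norm (s n))\<^sup>2) \<longlonglongrightarrow> 0"
  proof (rule tendsto_sandwich[OF _ _ tendsto_const])
    show "(\<lambda>n. K / Suc n) \<longlonglongrightarrow> 0"
      by (rule LIMSEQ_Suc[OF lim_const_over_n])
  qed (simp_all add: assms del: of_nat_Suc)
  then have "(\<lambda>n. sqrt ((norm (s n))\<^sup>2)) \<longlonglongrightarrow> sqrt 0"
    by (rule tendsto_real_sqrt)
  then show ?thesis by (simp add: tendsto_norm_zero_iff)
qed

context positive_contraction
begin

text \<open>A midpoint of two points of \<open>x + M\<close> is again in \<open>x + M\<close>, so by the parallelogram identity two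
  nearly minimal points are close with respect to the form. Moving along \<open>M\<close> cannot lower the
  form much, which makes \<open>T (z n)\<close> nearly orthogonal to \<open>M\<close>.\<close>

lemma minimizing_sequence:
  assumes M: "csubspace M"
  obtains z :: "nat \<Rightarrow> 'a" and q :: real where
    "\<And>n. z n - x \<in> M" "\<And>m. m \<in> M \<Longrightarrow> q \<le> quad T (x + m)"
    "\<And>n. quad T (z n) \<le> q + 1 / Suc n"
    "\<And>n k. n \<le> k \<Longrightarrow> quad T (z n - z k) \<le> 4 / Suc n"
    "\<And>n m. m \<in> M \<Longrightarrow> (cmod (cinner (T (z n)) m))\<^sup>2 \<le> quad T m / Suc n"
proof -
  note Ms = csubspaceD[OF M]
  define q where "q = Inf ((\<lambda>m. quad T (x + m)) ` M)"
  have bdd: "bdd_below ((\<lambda>m. quad T (x + m)) ` M)"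
    by (rule bdd_belowI2[of _ 0]) (simp add: nonneg)
  have q: "q \<le> quad T (x + m)" if "m \<in> M" for m
    unfolding q_def using that bdd by (simp add: cInf_lower)
  have "\<exists>m\<in>M. quad T (x + m) < q + 1 / Suc n" for n
    using cInf_lessD[of "(\<lambda>m. quad T (x + m)) ` M" "q + 1 / Suc n"] Ms(1)
    by (auto simp: q_def)
  then obtain m where m: "\<And>n. m n \<in> M" "\<And>n. quad T (x + m n) < q + 1 / Suc n"
    by metis
  define z where "z n = x + m n" for n
  show thesis
  proof
    show "z n - x \<in> M" for n by (simp add: z_def m)
    show "q \<le> quad T (x + m)" if "m \<in> M" for m by (fact q[OF that])
    show zq: "quad T (z n) \<le> q + 1 / Suc n" for n using m(2)[of n] by (simp add: z_def)
    show "quad T (z n - z k) \<le> 4 / Suc n" if "n \<le> k" for n k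
    proof -
      have e: "z n + z k = complex_of_real 2 *\<^sub>C (x + (1/2) *\<^sub>R (m n + m k))"
        unfolding scaleR_scaleC[of 2, symmetric] by (simp add: z_def algebra_simps scaleR_2)
      have "q \<le> quad T (x + (1/2) *\<^sub>R (m n + m k))"
        by (intro q Ms m)
      then have "4 * q \<le> quad T (z n + z k)"
        unfolding e quad_scaleC by simp
      moreover have "1 / Suc k \<le> 1 / real (Suc n)"
        using that by (simp add: frac_le)
      ultimately show ?thesis
        unfolding quad_parallelogram using zq[of n] zq[of k] by simp
    qed
    show "(cmod (cinner (T (z n)) m'))\<^sup>2 \<le> quad T m' / Suc n" if "m' \<in> M" for n m'
    proof -
      have "quad T (z n) \<le> quad T (z n + c *\<^sub>C m') + 1 / Suc n" for c
      proof -
        have "q \<le> quad T (x + (m n + c *\<^sub>C m'))"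
          by (intro q Ms m that)
        then show ?thesis
          using zq[of n] by (simp add: z_def add.assoc)
      qed
      then show ?thesis
        using near_minimizer_bound[of "z n" m' "1 / Suc n"] by simp
    qed
  qed
qed

end

text \<open>For a coercive form a minimizing sequence is Cauchy in norm, and its limit attains the
  minimum. With \<open>T = I\<close> this is the projection theorem; in general it inverts the compression of
  \<open>T\<inverse>\<close> to the orthogonal complement of \<open>M\<close>.\<close>

lemma coercive_minimizer:
  fixes T :: "'a::chilbert_space \<Rightarrow> 'a"
  assumes "positive_contraction T" "csubspace M" "closed M"
    and "0 < \<kappa>" "\<And>x. \<kappa> * (norm x)\<^sup>2 \<le> quad T x"
  obtains z where "z - x \<in> M" "T z \<in> orth_compl M"
proof -
  interpret positive_contraction T by fact
  obtain z where z: "\<And>n. z n - x \<in> M"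
    "\<And>n k. n \<le> k \<Longrightarrow> quad T (z n - z k) \<le> 4 / Suc n"
    "\<And>n m. m \<in> M \<Longrightarrow> (cmod (cinner (T (z n)) m))\<^sup>2 \<le> quad T m / Suc n"
    using minimizing_sequence[OF \<open>csubspace M\<close>, of x] by metis
  have "(norm (z n - z k))\<^sup>2 \<le> (4 / \<kappa>) / Suc n" if "n \<le> k" for n k
    using order_trans[OF assms(5) z(2)[OF that]] \<open>0 < \<kappa>\<close>
    by (simp add: pos_le_divide_eq mult_ac)
  then have "Cauchy z" by (rule Cauchy_of_square_bound)
  then obtain w where w: "z \<longlonglongrightarrow> w"
    using Cauchy_convergent convergent_def by blast
  show thesis
  proof
    have "(\<lambda>n. z n - x) \<longlonglongrightarrow> w - x" by (intro tendsto_intros w)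
    then show "w - x \<in> M"
      using closed_sequentially[OF \<open>closed M\<close>, of "\<lambda>n. z n - x" "w - x"] z(1) by simp
    show "T w \<in> orth_compl M"
    proof (rule orth_complI)
      fix m assume "m \<in> M"
      have "(\<lambda>n. cinner (T (z n)) m) \<longlonglongrightarrow> 0"
        by (rule tendsto_zero_of_square_bound) (rule z(3)[OF \<open>m \<in> M\<close>])
      moreover have "(\<lambda>n. cinner (T (z n)) m) \<longlonglongrightarrow> cinner (T w) m"
        unfolding symm by (intro tendsto_cinner w tendsto_const)
      ultimately show "cinner (T w) m = 0"
        using LIMSEQ_unique by blast
    qed
  qed
qed

lemma orthogonal_decomposition:
  fixes M :: "'a::chilbert_space set"
  assumes "csubspace M" "closed M"
  obtains n where "n - x \<in> M" "n \<in> orth_compl M"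
  using coercive_minimizer[OF positive_contraction_id assms, of 1 x]
  by (auto simp: quad_def Re_cinner_self)

lemma orth_compl_orth_compl:
  fixes M :: "'a::chilbert_space set"
  assumes "csubspace M" "closed M"
  shows "orth_compl (orth_compl M) = M"
proof
  show "orth_compl (orth_compl M) \<subseteq> M"
  proof
    fix x assume x: "x \<in> orth_compl (orth_compl M)"
    obtain n where n: "n - x \<in> M" "n \<in> orth_compl M"
      using orthogonal_decomposition[OF assms] .
    have "cinner n n = cinner n (n - x) + cinner n x" by (simp add: cinner_simps)
    then have "cinner n n = 0" using n x by (simp add: orth_complD orth_complD')
    then have "n = 0" by (simp add: cinner_self_eq_0)
    then show "x \<in> M" using csubspaceD(5)[OF assms(1) n(1)] by simp
  qed
  show "M \<subseteq> orth_compl (orth_compl M)"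
    by (blast intro: orth_complI orth_complD)
qed


section \<open>Compressed inverses and their limits\<close>

text \<open>The infimum over \<open>m \<in> M\<close> of \<open>quad T (x + m)\<close> is the form at \<open>x\<close> of the shorted operator of
  \<open>T\<close> to the orthogonal complement of \<open>M\<close>; the predicate says that this operator is zero.\<close>

definition shorted_zero :: "('a::complex_inner \<Rightarrow> 'a) \<Rightarrow> 'a set \<Rightarrow> bool" where
  "shorted_zero T M \<longleftrightarrow> (\<forall>x\<in>orth_compl M. \<forall>\<delta>>0. \<exists>m\<in>M. quad T (x + m) < \<delta>)"

text \<open>The graph of \<open>(P S\<inverse> \<restriction> N)\<inverse>\<close> with the orthogonal projector \<open>P\<close> onto \<open>N\<close>. The parameter is
  \<open>u = S\<inverse> w\<close> for \<open>w \<in> N\<close>, so that \<open>S\<inverse>\<close> itself does not occur.\<close>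

definition compressed_inverse :: "'a::complex_inner set \<Rightarrow> ('a \<Rightarrow> 'a) \<Rightarrow> 'a op" where
  "compressed_inverse N S = {(y, S u) | y u. y \<in> N \<and> S u \<in> N \<and> u - y \<in> orth_compl N}"

text \<open>The variational description of the Schur complement: \<open>u\<close> lies in \<open>y + M\<close> and \<open>S u\<close> is orthogonal
  to \<open>M\<close>, which is the stationarity condition for \<open>quad S\<close> on \<open>y + M\<close>.\<close>

lemma compressed_inverse_minimizes:
  fixes M :: "'a::chilbert_space set"
  assumes "positive_contraction S" "csubspace M" "closed M"
    and "(y, w) \<in> compressed_inverse (orth_compl M) S"
  obtains u where "w = S u" "u - y \<in> M" "Re (cinner w y) = quad S u" "(norm w)\<^sup>2 \<le> quad S u"
    "\<And>m. m \<in> M \<Longrightarrow> quad S u \<le> quad S (y + m)"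
proof -
  interpret positive_contraction S by fact
  obtain u where u: "w = S u" "S u \<in> orth_compl M" "u - y \<in> M"
    using assms(4) orth_compl_orth_compl[OF assms(2,3)] by (auto simp: compressed_inverse_def)
  show thesis
  proof
    show "w = S u" "u - y \<in> M" by (fact u)+
    have "cinner (S u) (u - y) = 0" using u by (simp add: orth_complD')
    then show "Re (cinner w y) = quad S u" by (simp add: u(1) quad_def cinner_simps)
    show "(norm w)\<^sup>2 \<le> quad S u" by (simp add: u(1) norm_T_le_quad)
    fix m assume "m \<in> M"
    then have "m - (u - y) \<in> M" using csubspaceD(6)[OF assms(2)] u(3) by blast
    then have "cinner (S u) (m - (u - y)) = 0" using u(2) by (simp add: orth_complD')
    then have "quad S (u + 1 *\<^sub>R (m - (u - y))) = quad S u + quad S (m - (u - y))"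
      unfolding quad_add_scaleR by simp
    then show "quad S u \<le> quad S (y + m)"
      using nonneg[of "m - (u - y)"] by (simp add: algebra_simps)
  qed
qed

text \<open>Coercivity gives existence of the minimizer and its uniqueness. The bound is 1 because
  \<open>\<parallel>w\<parallel>\<^sup>2 \<le> quad S u = (w, y)\<close>.\<close>

lemma bounded_compressed_inverse:
  fixes M :: "'a::chilbert_space set"
  assumes S: "positive_contraction S" and M: "csubspace M" "closed M"
    and coercive: "0 < \<kappa>" "\<And>x. \<kappa> * (norm x)\<^sup>2 \<le> quad S x"
  shows "bounded_op_in (orth_compl M) (compressed_inverse (orth_compl M) S)"
proof -
  interpret positive_contraction S by fact
  let ?N = "orth_compl M" and ?K = "compressed_inverse (orth_compl M) S"
  note N = csubspaceD[OF csubspace_orth_compl[of M]]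
  note Ms = csubspaceD[OF M(1)]
  have K: "?K = {(y, S u) | y u. y \<in> ?N \<and> S u \<in> ?N \<and> u - y \<in> M}"
    by (simp add: compressed_inverse_def orth_compl_orth_compl[OF M])
  have "single_valued ?K"
  proof (rule single_valuedI)
    fix y w w' assume "(y, w) \<in> ?K" "(y, w') \<in> ?K"
    then obtain u u' where u: "w = S u" "w' = S u'" "S u \<in> ?N" "S u' \<in> ?N" "u - y \<in> M" "u' - y \<in> M"
      by (auto simp: K)
    have "u - u' \<in> M" using Ms(6)[OF u(5,6)] by simp
    moreover have "S (u - u') \<in> ?N" using N(6)[OF u(3,4)] by (simp add: T_diff)
    ultimately have "quad S (u - u') = 0" by (simp add: quad_def orth_complD')
    then have "u - u' = 0" using coercive(2)[of "u - u'"] \<open>0 < \<kappa>\<close>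
      by (simp add: mult_le_0_iff)
    then show "w = w'" using u by simp
  qed
  moreover have "(0, 0) \<in> ?K"
    unfolding K using T_zero N(1) Ms(1) by force
  moreover have "(y + y', w + w') \<in> ?K" if yw: "(y, w) \<in> ?K" "(y', w') \<in> ?K" for y w y' w'
  proof -
    obtain u u' where u: "w = S u" "w' = S u'" "S u \<in> ?N" "S u' \<in> ?N" "u - y \<in> M" "u' - y' \<in> M"
      "y \<in> ?N" "y' \<in> ?N"
      using yw by (auto simp: K)
    have "w + w' = S (u + u')" "y + y' \<in> ?N" "S (u + u') \<in> ?N" "(u + u') - (y + y') \<in> M"
      using u N(2) Ms(2)[OF u(5,6)] by (simp_all add: T_add algebra_simps)
    then show ?thesis unfolding K by blast
  qed
  moreover have "(c *\<^sub>C y, c *\<^sub>C w) \<in> ?K" if yw: "(y, w) \<in> ?K" for c y w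
  proof -
    obtain u where u: "w = S u" "S u \<in> ?N" "u - y \<in> M" "y \<in> ?N"
      using yw by (auto simp: K)
    have "c *\<^sub>C w = S (c *\<^sub>C u)" "c *\<^sub>C y \<in> ?N" "S (c *\<^sub>C u) \<in> ?N" "c *\<^sub>C u - c *\<^sub>C y \<in> M"
      using u N(3) Ms(3)[OF u(3), of c] by (simp_all add: T_scaleC scaleC_diff_right)
    then show ?thesis unfolding K by blast
  qed
  moreover have "Domain ?K = ?N"
  proof
    show "?N \<subseteq> Domain ?K"
    proof
      fix y assume "y \<in> ?N"
      obtain u where "u - y \<in> M" "S u \<in> ?N"
        using coercive_minimizer[OF S M coercive] by blast
      then show "y \<in> Domain ?K" using \<open>y \<in> ?N\<close> unfolding K by blast
    qed
  qed (auto simp: K)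
  moreover have "Range ?K \<subseteq> ?N" by (auto simp: K)
  moreover have "norm w \<le> 1 * norm y" if yw: "(y, w) \<in> ?K" for y w
  proof -
    obtain u where u: "Re (cinner w y) = quad S u" "(norm w)\<^sup>2 \<le> quad S u"
      using compressed_inverse_minimizes[OF S M yw] by metis
    have "norm w * norm w \<le> norm w * norm y"
      using u complex_Re_le_cmod[of "cinner w y"] cinner_Cauchy_Schwarz[of w y]
      unfolding power2_eq_square by linarith
    then show ?thesis by (cases "w = 0") simp_all
  qed
  ultimately show ?thesis
    unfolding bounded_op_in_def linear_op_def by blast
qed

lemma op_apply_mem:
  assumes "single_valued T" "x \<in> Domain T"
  shows "(x, op_apply T x) \<in> T"
proof -
  obtain y where "(x, y) \<in> T" using assms(2) by blast
  moreover have "y' = y" if "(x, y') \<in> T" for y'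
    using single_valuedD[OF assms(1)] that \<open>(x, y) \<in> T\<close> by blast
  ultimately show ?thesis unfolding op_apply_def by (rule theI)
qed

lemma bounded_zero_op_in:
  assumes "csubspace N"
  shows "bounded_op_in N (zero_op_in N)"
  using csubspaceD(1-3)[OF assms]
  by (auto simp: bounded_op_in_def linear_op_def zero_op_in_def single_valued_def intro!: exI[of _ 0])

text \<open>Write \<open>w \<epsilon>\<close> for the value at \<open>x\<close> and \<open>q \<epsilon>\<close> for the minimum of the form of \<open>blend T \<epsilon>\<close> over
  \<open>x + M\<close>. Since \<open>\<parallel>w \<epsilon>\<parallel>\<^sup>2 \<le> q \<epsilon> = (w \<epsilon>, x)\<close>, convergence of \<open>w \<epsilon>\<close> to zero and of \<open>q \<epsilon>\<close> to
  zero are equivalent. The latter is compared with the infimum for \<open>T\<close> by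
  \<open>quad T z \<le> quad (blend T \<epsilon>) z \<le> quad T z + \<epsilon> \<parallel>z\<parallel>\<^sup>2\<close>.\<close>

lemma compressed_inverse_limit_zero_iff:
  fixes M :: "'a::chilbert_space set"
  assumes T: "positive_contraction T" and M: "csubspace M" "closed M"
  shows "strong_limit_in (orth_compl M) (\<lambda>\<epsilon>. compressed_inverse (orth_compl M) (blend T \<epsilon>))
    (zero_op_in (orth_compl M)) (at_right 0) \<longleftrightarrow> shorted_zero T M"
    (is "strong_limit_in ?N ?K _ _ \<longleftrightarrow> _")
proof -
  interpret positive_contraction T by fact
  define w where "w \<epsilon> x = op_apply (?K \<epsilon>) x" for \<epsilon> x
  have small: "\<forall>\<^sub>F \<epsilon> in at_right (0::real). 0 < \<epsilon> \<and> \<epsilon> < 1"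
    using eventually_at_right_real[of 0 1] by simp
  have bdd: "bounded_op_in ?N (?K \<epsilon>)" if "0 < \<epsilon>" "\<epsilon> < 1" for \<epsilon>
  proof (rule bounded_compressed_inverse[OF positive_contraction_blend[OF T] M \<open>0 < \<epsilon>\<close>])
    fix x
    have "0 \<le> (1 - \<epsilon>) * quad T x" using that nonneg[of x] by simp
    then show "\<epsilon> * (norm x)\<^sup>2 \<le> quad (blend T \<epsilon>) x"
      by (simp add: quad_blend algebra_simps)
  qed (use that in auto)
  have mem: "(x, w \<epsilon> x) \<in> ?K \<epsilon>" if "0 < \<epsilon>" "\<epsilon> < 1" "x \<in> ?N" for \<epsilon> x
    unfolding w_def using bdd[OF that(1,2)] that(3)
    by (intro op_apply_mem) (auto simp: bounded_op_in_def linear_op_def)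
  have zero: "op_apply (zero_op_in ?N) x = 0" if "x \<in> ?N" for x
    using that by (simp add: op_apply_def zero_op_in_def)
  have "strong_limit_in ?N ?K (zero_op_in ?N) (at_right 0) \<longleftrightarrow>
      (\<forall>x\<in>?N. ((\<lambda>\<epsilon>. w \<epsilon> x) \<longlongrightarrow> 0) (at_right 0))"
    using eventually_mono[OF small] bdd
    by (auto simp: strong_limit_in_def bounded_zero_op_in csubspace_orth_compl zero w_def)
  also have "\<dots> \<longleftrightarrow> shorted_zero T M"
  proof
    assume lim: "\<forall>x\<in>?N. ((\<lambda>\<epsilon>. w \<epsilon> x) \<longlongrightarrow> 0) (at_right 0)"
    show "shorted_zero T M"
      unfolding shorted_zero_def
    proof (intro ballI allI impI)
      fix x and \<delta> :: real assume x: "x \<in> ?N" and "0 < \<delta>"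
      have "((\<lambda>\<epsilon>. cmod (cinner (w \<epsilon> x) x)) \<longlongrightarrow> cmod (cinner 0 x)) (at_right 0)"
        using lim x by (intro tendsto_norm tendsto_cinner) auto
      then have "\<forall>\<^sub>F \<epsilon> in at_right 0. cmod (cinner (w \<epsilon> x) x) < \<delta>"
        using \<open>0 < \<delta>\<close> by (intro order_tendstoD(2)) auto
      then have "\<forall>\<^sub>F \<epsilon> in at_right 0. cmod (cinner (w \<epsilon> x) x) < \<delta> \<and> 0 < \<epsilon> \<and> \<epsilon> < 1"
        using small by eventually_elim auto
      then obtain \<epsilon> where \<epsilon>: "cmod (cinner (w \<epsilon> x) x) < \<delta>" "0 < \<epsilon>" "\<epsilon> < 1"
        using eventually_happens by force
      obtain u where u: "u - x \<in> M" "Re (cinner (w \<epsilon> x) x) = quad (blend T \<epsilon>) u"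
        using compressed_inverse_minimizes[OF positive_contraction_blend[OF T] M mem[OF \<epsilon>(2,3) x]] \<epsilon>
        by (metis less_imp_le)
      have "0 \<le> \<epsilon> * ((norm u)\<^sup>2 - quad T u)"
        using \<epsilon> le_norm[of u] by simp
      then have "quad T u \<le> quad (blend T \<epsilon>) u"
        by (simp add: quad_blend)
      also have "\<dots> < \<delta>"
        using u \<epsilon>(1) complex_Re_le_cmod[of "cinner (w \<epsilon> x) x"] by linarith
      finally show "\<exists>m\<in>M. quad T (x + m) < \<delta>"
        using u(1) by (intro bexI[of _ "u - x"]) auto
    qed
  next
    assume vanish: "shorted_zero T M"
    show "\<forall>x\<in>?N. ((\<lambda>\<epsilon>. w \<epsilon> x) \<longlongrightarrow> 0) (at_right 0)"
    proof (intro ballI tendstoI)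
      fix x and e :: real assume x: "x \<in> ?N" and "0 < e"
      obtain m where m: "m \<in> M" "quad T (x + m) < e\<^sup>2 / 2"
        using vanish x \<open>0 < e\<close> unfolding shorted_zero_def by (meson half_gt_zero zero_less_power)
      have "((\<lambda>\<epsilon>. \<epsilon> * (norm (x + m))\<^sup>2) \<longlongrightarrow> 0 * (norm (x + m))\<^sup>2) (at_right 0)"
        by (intro tendsto_intros)
      then have "\<forall>\<^sub>F \<epsilon> in at_right 0. \<epsilon> * (norm (x + m))\<^sup>2 < e\<^sup>2 / 2"
        using \<open>0 < e\<close> by (intro order_tendstoD(2)) auto
      with small show "\<forall>\<^sub>F \<epsilon> in at_right 0. dist (w \<epsilon> x) 0 < e"
      proof eventually_elim
        fix \<epsilon> :: real assume \<epsilon>: "0 < \<epsilon> \<and> \<epsilon> < 1" "\<epsilon> * (norm (x + m))\<^sup>2 < e\<^sup>2 / 2"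
        have "(norm (w \<epsilon> x))\<^sup>2 \<le> quad (blend T \<epsilon>) (x + m)"
          using compressed_inverse_minimizes[OF positive_contraction_blend[OF T] M
            mem[OF conjunct1[OF \<epsilon>(1)] conjunct2[OF \<epsilon>(1)] x]] \<epsilon>(1) m(1)
          by (metis less_imp_le order_trans)
        also have "\<dots> \<le> quad T (x + m) + \<epsilon> * (norm (x + m))\<^sup>2"
          using \<epsilon>(1) nonneg[of "x + m"] by (simp add: quad_blend right_diff_distrib)
        also have "\<dots> < e\<^sup>2" using m(2) \<epsilon>(2) by linarith
        finally show "dist (w \<epsilon> x) 0 < e"
          using \<open>0 < e\<close> by (simp add: power2_less_imp_less)
      qed
    qed
  qed
  finally show ?thesis .
qed

section \<open>Rigidity of positive contractions\<close>

lemma positive_contraction_eqI: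
  assumes "positive_contraction S" "positive_contraction T" "\<And>x. quad S x = quad T x"
  shows "S = T"
proof
  fix x
  interpret S: positive_contraction S by fact
  interpret T: positive_contraction T by fact
  have "Re (cinner (S x) y) = Re (cinner (T x) y)" for y
    using S.quad_add_scaleR[of x 1 y] T.quad_add_scaleR[of x 1 y] assms(3) by simp
  from this[of "S x - T x"] have "Re (cinner (S x - T x) (S x - T x)) = 0"
    by (simp add: cinner_diff_left)
  then show "S x = T x" by (simp add: Re_cinner_self)
qed

text \<open>The form of \<open>S - T\<close> is invariant under translations by \<open>M\<close> and bounded below by \<open>- quad T\<close>,
  whose supremum over each coset of \<open>M\<close> is zero.\<close>

lemma shorted_zero_imp_minimal:
  fixes M :: "'a::chilbert_space set"
  assumes S: "positive_contraction S" and T: "positive_contraction T"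
    and M: "csubspace M" "closed M"
    and agree: "\<And>m. m \<in> M \<Longrightarrow> S m = T m" and vanish: "shorted_zero T M"
  shows "quad T x \<le> quad S x"
proof -
  interpret S: positive_contraction S by fact
  interpret T: positive_contraction T by fact
  have shift: "quad S (y + m) - quad T (y + m) = quad S y - quad T y" if "m \<in> M" for y m
  proof -
    have "cinner (S y) m = cinner (T y) m" "quad S m = quad T m"
      using agree[OF that] by (simp_all add: S.symm T.symm quad_def)
    then show ?thesis
      using S.quad_add_scaleR[of y 1 m] T.quad_add_scaleR[of y 1 m] by simp
  qed
  obtain n where n: "n - x \<in> M" "n \<in> orth_compl M"
    using orthogonal_decomposition[OF M] .
  have "quad T n - quad S n \<le> \<delta>" if \<delta>: "0 < \<delta>" for \<delta>
  proof -
    obtain m where "m \<in> M" "quad T (n + m) < \<delta>"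
      using vanish n(2) \<delta> unfolding shorted_zero_def by blast
    then show ?thesis using shift[of m n] S.nonneg[of "n + m"] by linarith
  qed
  then have "quad T n - quad S n \<le> 0" by (rule field_le_epsilon) simp
  then show ?thesis using shift[OF n(1), of x] by simp
qed

text \<open>The bound on \<open>cinner y v\<close> says that the rank-one operator \<open>(\<cdot>, v) v / q\<close> lies below \<open>T\<close>. Here \<open>q\<close> is
  the infimum of the form over a coset \<open>x + M\<close> on which it is positive, and \<open>v\<close> is the limit of \<open>T\<close>
  along a minimizing sequence.\<close>

lemma not_shorted_zero_imp_minorant:
  fixes T :: "'a::chilbert_space \<Rightarrow> 'a"
  assumes T: "positive_contraction T" and M: "csubspace M" and not_zero: "\<not> shorted_zero T M"
  obtains q :: real and v where "0 < q" "v \<in> orth_compl M" "v \<noteq> 0"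
    "\<And>y. (cmod (cinner y v))\<^sup>2 \<le> q * quad T y"
proof -
  interpret positive_contraction T by fact
  obtain x \<delta> where x: "0 < \<delta>" "\<And>m. m \<in> M \<Longrightarrow> \<delta> \<le> quad T (x + m)"
    using not_zero by (auto simp: shorted_zero_def not_less)
  obtain z q where z: "\<And>n. z n - x \<in> M" "\<And>m. m \<in> M \<Longrightarrow> q \<le> quad T (x + m)"
    "\<And>n. quad T (z n) \<le> q + 1 / Suc n"
    "\<And>n k. n \<le> k \<Longrightarrow> quad T (z n - z k) \<le> 4 / Suc n"
    "\<And>n m. m \<in> M \<Longrightarrow> (cmod (cinner (T (z n)) m))\<^sup>2 \<le> quad T m / Suc n"
    using minimizing_sequence[OF M, of x] by metis
  have qz: "q \<le> quad T (z n)" "\<delta> \<le> quad T (z n)" for n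
    using z(2)[OF z(1)[of n]] x(2)[OF z(1)[of n]] by simp_all
  have "(\<lambda>n. q + 1 / Suc n) \<longlonglongrightarrow> q + 0"
    by (intro tendsto_add tendsto_const LIMSEQ_Suc[OF lim_const_over_n])
  then have q_lim: "(\<lambda>n. q + 1 / Suc n) \<longlonglongrightarrow> q" by simp
  have "\<delta> \<le> q"
    by (rule LIMSEQ_le_const[OF q_lim]) (meson order_trans qz(2) z(3))
  then have "0 < q" using x(1) by linarith
  have "(norm (T (z n) - T (z k)))\<^sup>2 \<le> 4 / Suc n" if "n \<le> k" for n k
    using norm_T_le_quad[of "z n - z k"] z(4)[OF that] by (simp add: T_diff)
  then have "Cauchy (\<lambda>n. T (z n))" by (rule Cauchy_of_square_bound)
  then obtain v where v: "(\<lambda>n. T (z n)) \<longlonglongrightarrow> v"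
    using Cauchy_convergent convergent_def by blast
  have v_cinner: "(\<lambda>n. cinner (T (z n)) y) \<longlonglongrightarrow> cinner v y" for y
    by (intro tendsto_cinner v tendsto_const)
  \<comment> \<open>\<open>z n\<close> may be unbounded in norm; only its form is bounded, which is what the estimate uses.\<close>
  have "(\<lambda>n. cinner (T (z n)) (z n - x)) \<longlonglongrightarrow> 0"
  proof (rule tendsto_zero_of_square_bound)
    fix n
    have "quad T (z n - x) \<le> 2 * quad T (z n) + 2 * quad T x"
      using quad_parallelogram[of "z n" x] nonneg[of "z n + x"] by linarith
    also have "quad T (z n) \<le> q + 1"
      using z(3)[of n] by (rule order_trans) simp
    finally have "quad T (z n - x) / Suc n \<le> (2 * (q + 1) + 2 * quad T x) / Suc n"
      by (intro divide_right_mono) auto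
    then show "(norm (cinner (T (z n)) (z n - x)))\<^sup>2 \<le> (2 * (q + 1) + 2 * quad T x) / Suc n"
      using z(5)[OF z(1)[of n], of n] by linarith
  qed
  then have "(\<lambda>n. Re (cinner (T (z n)) x + cinner (T (z n)) (z n - x))) \<longlonglongrightarrow> Re (cinner v x + 0)"
    by (intro tendsto_intros v_cinner)
  then have "q \<le> Re (cinner v x + 0)"
    by (rule LIMSEQ_le_const) (use qz(1) in \<open>simp add: quad_def cinner_simps\<close>)
  then have "v \<noteq> 0" using \<open>0 < q\<close> by auto
  have "v \<in> orth_compl M"
  proof (rule orth_complI)
    fix m assume "m \<in> M"
    have "(\<lambda>n. cinner (T (z n)) m) \<longlonglongrightarrow> 0"
      by (rule tendsto_zero_of_square_bound) (rule z(5)[OF \<open>m \<in> M\<close>])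
    then show "cinner v m = 0" using v_cinner LIMSEQ_unique by blast
  qed
  moreover have "(cmod (cinner y v))\<^sup>2 \<le> q * quad T y" for y
  proof (rule LIMSEQ_le)
    show "(\<lambda>n. (cmod (cinner y (T (z n))))\<^sup>2) \<longlonglongrightarrow> (cmod (cinner y v))\<^sup>2"
      by (intro tendsto_intros tendsto_cinner v)
    show "(\<lambda>n. (q + 1 / Suc n) * quad T y) \<longlonglongrightarrow> q * quad T y"
      by (intro tendsto_mult q_lim tendsto_const)
    show "\<exists>n0. \<forall>n\<ge>n0. (cmod (cinner y (T (z n))))\<^sup>2 \<le> (q + 1 / Suc n) * quad T y"
    proof (intro exI allI impI)
      fix n
      have "(cmod (cinner y (T (z n))))\<^sup>2 \<le> quad T y * quad T (z n)"
        using form_Cauchy_Schwarz[of y "z n"] by (simp add: symm)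
      also have "\<dots> \<le> quad T y * (q + 1 / Suc n)"
        by (intro mult_left_mono z nonneg)
      finally show "(cmod (cinner y (T (z n))))\<^sup>2 \<le> (q + 1 / Suc n) * quad T y"
        by (simp add: mult.commute)
    qed
  qed
  ultimately show thesis using that \<open>0 < q\<close> \<open>v \<noteq> 0\<close> by blast
qed

lemma not_shorted_zero_imp_perturbation:
  fixes T :: "'a::chilbert_space \<Rightarrow> 'a"
  assumes T: "positive_contraction T" and "csubspace M" "\<not> shorted_zero T M"
  obtains S where "positive_contraction S" "\<And>m. m \<in> M \<Longrightarrow> S m = T m" "S \<noteq> T"
proof -
  interpret positive_contraction T by fact
  obtain q v where v: "0 < q" "v \<in> orth_compl M" "v \<noteq> 0"
    "\<And>y. (cmod (cinner y v))\<^sup>2 \<le> q * quad T y"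
    using not_shorted_zero_imp_minorant[OF assms] by blast
  \<comment> \<open>The subtracted rank-one operator vanishes on \<open>M\<close> because \<open>v\<close> is orthogonal to \<open>M\<close>.\<close>
  define S where "S y = T y - (cinner y v / q) *\<^sub>C v" for y
  have quad_S: "quad S y = quad T y - (cmod (cinner y v))\<^sup>2 / q" for y
  proof -
    have "cinner (S y) y = cinner (T y) y - cinner y v * cnj (cinner y v) / q"
      by (simp add: S_def cinner_simps cinner_commute[of v y])
    also have "cinner y v * cnj (cinner y v) = complex_of_real ((cmod (cinner y v))\<^sup>2)"
      by (rule complex_norm_square[symmetric])
    finally have "cinner (S y) y = complex_of_real (quad T y - (cmod (cinner y v))\<^sup>2 / q)"
      by (simp add: cinner_T_self)
    then show ?thesis by (simp add: quad_def)
  qed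
  have "positive_contraction S"
  proof
    show "cinner (S x) y = cinner x (S y)" for x y
      by (simp add: S_def cinner_simps symm) (simp add: cinner_commute[of v y])
    show "0 \<le> quad S x" for x
      using v(1) v(4)[of x] by (simp add: quad_S field_simps)
    show "quad S x \<le> (norm x)\<^sup>2" for x
      using v(1) le_norm[of x] by (simp add: quad_S) (smt (verit) zero_le_divide_iff zero_le_power2)
  qed
  moreover have "S m = T m" if "m \<in> M" for m
    using orth_complD[OF v(2) that] scaleR_scaleC[of 0 v] by (simp add: S_def)
  moreover have "quad S v \<noteq> quad T v"
    using v(1,3) by (simp add: quad_S cinner_self_eq_0)
  ultimately show thesis using that by metis
qed

text \<open>The complement \<open>T \<mapsto> I - T\<close> exchanges the lower bound \<open>0\<close> and the upper bound \<open>I\<close>, so both halves of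
  the criterion follow from statements about operators below \<open>T\<close>.\<close>

lemma unique_positive_contraction_iff:
  fixes T :: "'a::chilbert_space \<Rightarrow> 'a"
  assumes T: "positive_contraction T" and M: "csubspace M" "closed M"
  shows "(\<forall>S. positive_contraction S \<longrightarrow> (\<forall>m\<in>M. S m = T m) \<longrightarrow> S = T) \<longleftrightarrow>
    shorted_zero T M \<and> shorted_zero (\<lambda>x. x - T x) M"
proof (intro iffI conjI allI impI)
  assume unique: "\<forall>S. positive_contraction S \<longrightarrow> (\<forall>m\<in>M. S m = T m) \<longrightarrow> S = T"
  show "shorted_zero T M"
    using not_shorted_zero_imp_perturbation[OF T M(1)] unique by metis
  show "shorted_zero (\<lambda>x. x - T x) M"
  proof (rule ccontr)
    assume "\<not> ?thesis"
    then obtain S where S: "positive_contraction S" "\<And>m. m \<in> M \<Longrightarrow> S m = m - T m"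
      "S \<noteq> (\<lambda>x. x - T x)"
      using not_shorted_zero_imp_perturbation[OF positive_contraction_complement[OF T] M(1)] by metis
    have eq: "(\<lambda>x. x - S x) = T"
      using unique positive_contraction_complement[OF S(1)] S(2) by simp
    have "S = (\<lambda>x. x - T x)" by (simp add: eq[symmetric])
    with S(3) show False by simp
  qed
next
  fix S assume vanish: "shorted_zero T M \<and> shorted_zero (\<lambda>x. x - T x) M"
    and S: "positive_contraction S" and agree: "\<forall>m\<in>M. S m = T m"
  show "S = T"
  proof (rule positive_contraction_eqI[OF S T])
    fix x
    have "quad T x \<le> quad S x"
      using shorted_zero_imp_minimal[OF S T M] agree vanish by blast
    moreover have "quad (\<lambda>x. x - T x) x \<le> quad (\<lambda>x. x - S x) x"
      using shorted_zero_imp_minimal[OF positive_contraction_complement[OF S]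
        positive_contraction_complement[OF T] M] agree vanish by simp
    ultimately show "quad S x = quad T x" by (simp add: quad_complement)
  qed
qed

section \<open>Resolvents of nonnegative operators\<close>

definition shifted_range :: "'a::complex_inner op \<Rightarrow> 'a set" where
  "shifted_range A = {f + g | f g. (f, g) \<in> A}"

lemma shifted_rangeI: "(f, g) \<in> A \<Longrightarrow> f + g \<in> shifted_range A"
  unfolding shifted_range_def by blast

lemma linear_opD:
  assumes "linear_op T"
  shows "single_valued T" "(0, 0) \<in> T" "(x, y) \<in> T \<Longrightarrow> (x', y') \<in> T \<Longrightarrow> (x + x', y + y') \<in> T"
    "(x, y) \<in> T \<Longrightarrow> (c *\<^sub>C x, c *\<^sub>C y) \<in> T"
    "(x, y) \<in> T \<Longrightarrow> (x', y') \<in> T \<Longrightarrow> (x - x', y - y') \<in> T"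
proof -
  note lin = assms[unfolded linear_op_def]
  show "single_valued T" "(0, 0) \<in> T"
    using lin by simp_all
  show add: "(x, y) \<in> T \<Longrightarrow> (x', y') \<in> T \<Longrightarrow> (x + x', y + y') \<in> T" for x y x' y'
    by (rule lin[THEN conjunct2, THEN conjunct2, THEN conjunct1, rule_format])
  show scale: "(x, y) \<in> T \<Longrightarrow> (c *\<^sub>C x, c *\<^sub>C y) \<in> T" for x y c
    by (rule lin[THEN conjunct2, THEN conjunct2, THEN conjunct2, rule_format])
  show "(x, y) \<in> T \<Longrightarrow> (x', y') \<in> T \<Longrightarrow> (x - x', y - y') \<in> T"
    using add[of x y "- x'" "- y'"] scale[of x' y' "- 1"] by simp
qed

lemma nonnegative_opD:
  assumes "nonnegative_op T" "(x, y) \<in> T"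
  shows "0 \<le> Re (cinner y x)" "Re (cinner x y) = Re (cinner y x)"
proof -
  have "cinner y x \<in> \<real>\<^sub>\<ge>\<^sub>0" using assms unfolding nonnegative_op_def by blast
  then show "0 \<le> Re (cinner y x)" by (simp add: complex_nonneg_Reals_iff)
  show "Re (cinner x y) = Re (cinner y x)" by (rule Re_cinner_commute)
qed

lemma norm_add_square:
  "(norm (x + y))\<^sup>2 = (norm x)\<^sup>2 + 2 * Re (cinner y x) + (norm (y::'a::complex_inner))\<^sup>2"
proof -
  have "Re (cinner (x + y) (x + y)) = Re (cinner x x) + 2 * Re (cinner y x) + Re (cinner y y)"
    using Re_cinner_commute[of x y] by (simp add: cinner_simps)
  then show ?thesis by (simp only: Re_cinner_self)
qed

lemma norm_le_norm_shifted:
  assumes "nonnegative_op T" "(f, g) \<in> T"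
  shows "norm f \<le> norm (f + g)"
proof (rule power2_le_imp_le)
  show "(norm f)\<^sup>2 \<le> (norm (f + g))\<^sup>2"
    unfolding norm_add_square using nonnegative_opD(1)[OF assms] by simp
qed simp

lemma orth_compl_shifted_range_iff: "x \<in> orth_compl (shifted_range A) \<longleftrightarrow> (x, - x) \<in> adjoint_op A"
proof -
  have "x \<in> orth_compl (shifted_range A) \<longleftrightarrow> (\<forall>f g. (f, g) \<in> A \<longrightarrow> cinner (f + g) x = 0)"
    unfolding orth_compl_def shifted_range_def by blast
  also have "\<dots> \<longleftrightarrow> (\<forall>f g. (f, g) \<in> A \<longrightarrow> cinner g x = cinner f (- x))"
    by (simp add: cinner_simps add_eq_0_iff)
  also have "\<dots> \<longleftrightarrow> (x, - x) \<in> adjoint_op A"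
    unfolding adjoint_op_def by blast
  finally show ?thesis .
qed

lemma defect_subspace_eq_orth_compl: "defect_subspace A (- 1) = orth_compl (shifted_range A)"
  by (auto simp: defect_subspace_def op_ker_def op_add_def op_scale_def add_eq_0_iff2
      orth_compl_shifted_range_iff)

lemma csubspace_shifted_range:
  assumes "linear_op A"
  shows "csubspace (shifted_range A)"
  unfolding csubspace_def shifted_range_def
proof (intro conjI ballI allI)
  show "0 \<in> {f + g |f g. (f, g) \<in> A}" using linear_opD(2)[OF assms] by force
next
  fix x y assume "x \<in> {f + g |f g. (f, g) \<in> A}" "y \<in> {f + g |f g. (f, g) \<in> A}"
  then obtain f g f' g' where "x = f + g" "y = f' + g'" "(f, g) \<in> A" "(f', g') \<in> A" by blast
  then show "x + y \<in> {f + g |f g. (f, g) \<in> A}"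
    using linear_opD(3)[OF assms, of f g f' g']
    by (intro CollectI exI[of _ "f + f'"] exI[of _ "g + g'"]) (simp add: algebra_simps)
next
  fix c x assume "x \<in> {f + g |f g. (f, g) \<in> A}"
  then obtain f g where "x = f + g" "(f, g) \<in> A" by blast
  then show "c *\<^sub>C x \<in> {f + g |f g. (f, g) \<in> A}"
    using linear_opD(4)[OF assms, of f g c] by (auto simp: scaleC_add_right)
qed

text \<open>On the graph, the norm of \<open>f\<close> is bounded by that of \<open>f + g\<close>, so a convergent sequence in the
  range comes from a convergent sequence in the graph.\<close>

lemma closed_shifted_range:
  fixes A :: "'a::chilbert_space op"
  assumes "linear_op A" "nonnegative_op A" "closed A"
  shows "closed (shifted_range A)"
  unfolding closed_sequential_limits
proof (intro allI impI, elim conjE)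
  fix s x assume "\<forall>n. s n \<in> shifted_range A" and s: "s \<longlonglongrightarrow> x"
  then obtain f g where fg: "\<And>n. s n = f n + g n" "\<And>n. (f n, g n) \<in> A"
    unfolding shifted_range_def by simp metis
  have "norm (f n - f k) \<le> norm (s n - s k)" for n k
    using norm_le_norm_shifted[OF assms(2) linear_opD(5)[OF assms(1) fg(2)[of n] fg(2)[of k]]]
    by (simp add: fg(1) algebra_simps)
  then have "Cauchy f"
    using LIMSEQ_imp_Cauchy[OF s] unfolding Cauchy_def dist_norm by (meson le_less_trans)
  then obtain h where h: "f \<longlonglongrightarrow> h"
    using Cauchy_convergent convergent_def by blast
  have "g = (\<lambda>n. s n - f n)" by (simp add: fg(1))
  then have "g \<longlonglongrightarrow> x - h" using tendsto_diff[OF s h] by simp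
  then have "(\<lambda>n. (f n, g n)) \<longlonglongrightarrow> (h, x - h)" by (intro tendsto_Pair h)
  then have "(h, x - h) \<in> A"
    using closed_sequentially[OF assms(3), of "\<lambda>n. (f n, g n)"] fg(2) by blast
  then show "x \<in> shifted_range A" unfolding shifted_range_def by force
qed

lemma closed_adjoint_op: "closed (adjoint_op T)"
  unfolding closed_sequential_limits
proof (intro allI impI, elim conjE)
  fix s and l :: "'a \<times> 'a" assume s: "\<forall>n. s n \<in> adjoint_op T" and l: "s \<longlonglongrightarrow> l"
  have "cinner w (fst l) = cinner x (snd l)" if "(x, w) \<in> T" for x w
  proof (rule LIMSEQ_unique)
    show "(\<lambda>n. cinner w (fst (s n))) \<longlonglongrightarrow> cinner w (fst l)"
      by (intro tendsto_cinner tendsto_const tendsto_fst l)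
    have "cinner w (fst (s n)) = cinner x (snd (s n))" for n
      using spec[OF s, of n] that by (cases "s n") (auto simp: adjoint_op_def)
    then show "(\<lambda>n. cinner w (fst (s n))) \<longlonglongrightarrow> cinner x (snd l)"
      by (simp add: tendsto_cinner tendsto_snd l)
  qed
  then show "l \<in> adjoint_op T" by (auto simp: adjoint_op_def case_prod_unfold)
qed

text \<open>The value of \<open>(B + I)\<inverse>\<close> at \<open>u\<close>; \<open>(f, u - f) \<in> B\<close> says that \<open>B + I\<close> sends \<open>f\<close> to \<open>u\<close>.\<close>

definition resolvent :: "'a::complex_inner op \<Rightarrow> 'a \<Rightarrow> 'a" where
  "resolvent B u = (THE f. (f, u - f) \<in> B)"

lemma resolvent_eqI:
  assumes "linear_op B" "nonnegative_op B" "(f, g) \<in> B"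
  shows "resolvent B (f + g) = f"
  unfolding resolvent_def
proof (rule the_equality)
  show "(f, f + g - f) \<in> B" using assms(3) by simp
  fix f' assume "(f', f + g - f') \<in> B"
  from linear_opD(5)[OF assms(1) this assms(3)]
  have "(f' - f, f - f') \<in> B" by simp
  from norm_le_norm_shifted[OF assms(2) this] show "f' = f" by simp
qed

text \<open>The range is closed, and a vector \<open>n\<close> orthogonal to it satisfies \<open>B n = - n\<close> by
  self-adjointness, which nonnegativity allows only for \<open>n = 0\<close>.\<close>

lemma shifted_range_selfadjoint:
  fixes B :: "'a::chilbert_space op"
  assumes "selfadjoint_op B" "nonnegative_op B"
  shows "shifted_range B = UNIV"
proof -
  have B: "linear_op B" "adjoint_op B = B" using assms by (auto simp: selfadjoint_op_def)
  have "closed B" using closed_adjoint_op[of B] B by simp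
  have "x \<in> shifted_range B" for x
  proof -
    obtain n where n: "n - x \<in> shifted_range B" "n \<in> orth_compl (shifted_range B)"
      using orthogonal_decomposition[OF csubspace_shifted_range[OF B(1)]
        closed_shifted_range[OF B(1) assms(2) \<open>closed B\<close>]] .
    have "(n, - n) \<in> adjoint_op B"
      using n(2) by (simp add: orth_compl_shifted_range_iff)
    then have "norm n \<le> norm (n + - n)"
      unfolding B(2) by (rule norm_le_norm_shifted[OF assms(2)])
    then have "n = 0" by simp
    then show ?thesis using csubspaceD(5)[OF csubspace_shifted_range[OF B(1)] n(1)] by simp
  qed
  then show ?thesis by blast
qed

lemma resolvent_mem:
  fixes B :: "'a::chilbert_space op"
  assumes "selfadjoint_op B" "nonnegative_op B"
  shows "(resolvent B u, u - resolvent B u) \<in> B"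
proof -
  have "u \<in> shifted_range B" using shifted_range_selfadjoint[OF assms] by simp
  then obtain f g where fg: "u = f + g" "(f, g) \<in> B" unfolding shifted_range_def by blast
  then have "resolvent B u = f"
    using resolvent_eqI[OF _ assms(2)] assms(1) by (simp add: selfadjoint_op_def)
  then show ?thesis using fg by simp
qed

lemma mem_iff_resolvent:
  fixes B :: "'a::chilbert_space op"
  assumes "selfadjoint_op B" "nonnegative_op B"
  shows "(f, g) \<in> B \<longleftrightarrow> resolvent B (f + g) = f"
proof
  show "(f, g) \<in> B \<Longrightarrow> resolvent B (f + g) = f"
    using assms by (intro resolvent_eqI) (simp_all add: selfadjoint_op_def)
  show "resolvent B (f + g) = f \<Longrightarrow> (f, g) \<in> B"
    using resolvent_mem[OF assms, of "f + g"] by simp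
qed

lemma positive_contraction_resolvent:
  fixes B :: "'a::chilbert_space op"
  assumes "selfadjoint_op B" "nonnegative_op B"
  shows "positive_contraction (resolvent B)"
proof
  fix u v
  note mem = resolvent_mem[OF assms]
  have "(resolvent B v, v - resolvent B v) \<in> adjoint_op B"
    using mem assms(1) by (simp add: selfadjoint_op_def)
  then have "cinner (u - resolvent B u) (resolvent B v) = cinner (resolvent B u) (v - resolvent B v)"
    using mem[of u] by (auto simp: adjoint_op_def)
  then show "cinner (resolvent B u) v = cinner u (resolvent B v)"
    by (simp add: cinner_simps)
next
  fix u
  define f g where "f = resolvent B u" and "g = u - f"
  have u: "u = f + g" by (simp add: g_def)
  have "(f, g) \<in> B" using resolvent_mem[OF assms, of u] by (simp add: f_def g_def)
  note nn = nonnegative_opD[OF assms(2) this]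
  have q: "quad (resolvent B) u = (norm f)\<^sup>2 + Re (cinner g f)"
    unfolding quad_def f_def[symmetric] using nn(2) by (simp add: u cinner_simps Re_cinner_self)
  show "0 \<le> quad (resolvent B) u" using nn(1) by (simp add: q)
  show "quad (resolvent B) u \<le> (norm u)\<^sup>2"
    unfolding q unfolding u norm_add_square using nn(1) zero_le_power2[of "norm g"] by linarith
qed

text \<open>The extension is \<open>D\<inverse> - I\<close>. The kernel of \<open>D\<close> is orthogonal to its range, which contains the
  dense domain of \<open>A\<close>; hence \<open>D\<close> is injective. Nonnegativity is \<open>D\<^sup>2 \<le> D\<close>.\<close>

lemma extension_from_positive_contraction:
  fixes A :: "'a::chilbert_space op"
  assumes D: "positive_contraction D" and dense: "densely_defined A"
    and agree: "\<And>f g. (f, g) \<in> A \<Longrightarrow> D (f + g) = f"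
  obtains B where "nonneg_sa_extension A B" "resolvent B = D"
proof -
  interpret positive_contraction D by fact
  define B where "B = {(D u, u - D u) | u. True}"
  have BI: "(D u, u - D u) \<in> B" for u by (auto simp: B_def)
  have AB: "A \<subseteq> B"
  proof
    fix p assume "p \<in> A"
    then obtain f g where "p = (f, g)" "D (f + g) = f" using agree by (cases p) blast
    then show "p \<in> B" using BI[of "f + g"] by simp
  qed
  have inj: "u = 0" if "D u = 0" for u
  proof -
    have "cinner f u = 0" if "(f, g) \<in> A" for f g
      using agree[OF that] symm[of "f + g" u] \<open>D u = 0\<close> by simp
    then have "Domain A \<subseteq> {f. cinner f u = 0}" by blast
    moreover have "closed {f. cinner f u = 0}"
    proof (rule closed_Collect_eq)
      show "continuous_on UNIV (\<lambda>f. cinner f u)"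
        by (intro bounded_linear.continuous_on[OF
          bounded_bilinear.bounded_linear_left[OF bounded_bilinear_cinner]] continuous_on_id)
    qed simp
    ultimately have "closure (Domain A) \<subseteq> {f. cinner f u = 0}" by (rule closure_minimal)
    then have "cinner u u = 0" using dense by (auto simp: densely_defined_def)
    then show ?thesis by (simp add: cinner_self_eq_0)
  qed
  have "linear_op B"
    unfolding linear_op_def
  proof (intro conjI allI impI)
    show "single_valued B"
    proof (rule single_valuedI)
      fix x y y' assume "(x, y) \<in> B" "(x, y') \<in> B"
      then obtain u u' where u: "x = D u" "y = u - D u" "x = D u'" "y' = u' - D u'"
        unfolding B_def by blast
      then have "D (u - u') = 0" by (simp add: T_diff)
      then show "y = y'" using inj[of "u - u'"] u by simp
    qed
    show "(0, 0) \<in> B" using BI[of 0] by (simp add: T_zero)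
    fix x y assume "(x, y) \<in> B"
    then obtain u where u: "x = D u" "y = u - D u" by (auto simp: B_def)
    show "(x + x', y + y') \<in> B" if xy': "(x', y') \<in> B" for x' y'
    proof -
      obtain u' where u': "x' = D u'" "y' = u' - D u'" using xy' by (auto simp: B_def)
      show ?thesis using BI[of "u + u'"] by (simp add: u u' T_add algebra_simps)
    qed
    show "(c *\<^sub>C x, c *\<^sub>C y) \<in> B" for c
      using BI[of "c *\<^sub>C u"] by (simp add: u T_scaleC scaleC_diff_right)
  qed
  moreover have "densely_defined B"
    using dense Domain_mono[OF AB] closure_mono unfolding densely_defined_def by blast
  moreover have "adjoint_op B = B"
  proof
    show "adjoint_op B \<subseteq> B"
    proof
      fix p assume "p \<in> adjoint_op B"
      then obtain y z where p: "p = (y, z)"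
        and adj: "\<And>u. cinner (u - D u) y = cinner (D u) z"
        using BI by (cases p) (auto simp: adjoint_op_def)
      have "cinner u y = cinner u (D (y + z))" for u
        using adj[of u] symm[of u "y + z"]
        by (simp add: cinner_simps diff_eq_eq add.commute)
      then have "cinner (y - D (y + z)) (y - D (y + z)) = 0"
        by (simp add: cinner_diff_right)
      then have "y = D (y + z)" by (simp add: cinner_self_eq_0)
      then show "p \<in> B" using BI[of "y + z"] by (simp add: p)
    qed
    show "B \<subseteq> adjoint_op B"
      by (auto simp: B_def adjoint_op_def cinner_simps symm)
  qed
  moreover have "nonnegative_op B"
    unfolding nonnegative_op_def
  proof clarify
    fix x y assume "(x, y) \<in> B"
    then obtain u where u: "x = D u" "y = u - D u" by (auto simp: B_def)
    have "cinner y x = complex_of_real (quad D u - (norm (D u))\<^sup>2)"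
      using cinner_T_self[of u] by (simp add: u cinner_diff_left cinner_self symm)
    then show "cinner y x \<in> \<real>\<^sub>\<ge>\<^sub>0"
      using norm_T_le_quad[of u] by (simp add: complex_nonneg_Reals_iff del: of_real_diff)
  qed
  ultimately have B: "nonneg_sa_extension A B" "linear_op B" "nonnegative_op B"
    using AB by (auto simp: nonneg_sa_extension_def selfadjoint_op_def)
  moreover have "resolvent B u = D u" for u
    using resolvent_eqI[OF B(2,3) BI[of u]] by simp
  ultimately show thesis using that by blast
qed

text \<open>Parametrize the graph of \<open>A0\<close> by \<open>u \<mapsto> (C u, u - C u)\<close> with \<open>C = (A0 + I)\<inverse>\<close>. Then \<open>A0 + I\<close>
  sends \<open>C u\<close> to \<open>u\<close>, while \<open>A0 + \<epsilon>\<close> and \<open>\<epsilon> A0 + I\<close> send it to \<open>(u - C u) + \<epsilon> C u\<close> and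
  \<open>C u + \<epsilon> (u - C u)\<close>.\<close>

lemma compressed_inverse_of_resolvent:
  fixes A0 :: "'a::chilbert_space op"
  assumes A0: "selfadjoint_op A0" "nonnegative_op A0"
  shows "(op_restrict (op_comp (orth_projector N) (op_comp (op_add A0 Id)
       ((op_add A0 (op_scale (complex_of_real \<epsilon>) Id))\<inverse>))) N)\<inverse>
     = compressed_inverse N (blend (\<lambda>u. u - resolvent A0 u) \<epsilon>)" (is "?L1 = ?R1")
    and "(op_restrict (op_comp (orth_projector N) (op_comp (op_add A0 Id)
       ((op_add (op_scale (complex_of_real \<epsilon>) A0) Id)\<inverse>))) N)\<inverse>
     = compressed_inverse N (blend (resolvent A0) \<epsilon>)" (is "?L2 = ?R2")
proof -
  let ?C = "resolvent A0"
  have sv: "single_valued A0" using A0 by (simp add: selfadjoint_op_def linear_op_def)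
  have P: "(u, y) \<in> orth_projector N \<longleftrightarrow> y \<in> N \<and> u - y \<in> orth_compl N" for u y
    by (auto simp: orth_projector_def intro: orth_complI orth_complD')
  have param: "(c, g) \<in> A0 \<longleftrightarrow> (\<exists>u. c = ?C u \<and> g = u - ?C u)" for c g
  proof
    assume "(c, g) \<in> A0"
    then have "?C (c + g) = c" using mem_iff_resolvent[OF A0] by blast
    then show "\<exists>u. c = ?C u \<and> g = u - ?C u" by (intro exI[of _ "c + g"]) simp
  next
    assume "\<exists>u. c = ?C u \<and> g = u - ?C u"
    then show "(c, g) \<in> A0" using resolvent_mem[OF A0] by auto
  qed
  have ex: "(\<exists>g. (c, g) \<in> A0 \<and> Q g) \<longleftrightarrow> (\<exists>u. c = ?C u \<and> Q (u - ?C u))" for c Q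
    unfolding param by blast
  have "(c, b) \<in> op_add A0 Id \<longleftrightarrow> (\<exists>g. (c, g) \<in> A0 \<and> b = g + c)" for c b
    by (auto simp: op_add_def)
  then have add_Id: "(c, b) \<in> op_add A0 Id \<longleftrightarrow> (\<exists>u. c = ?C u \<and> b = u)" for c b
    unfolding ex by auto
  have "(c, a) \<in> op_add A0 (op_scale (complex_of_real \<epsilon>) Id) \<longleftrightarrow>
      (\<exists>g. (c, g) \<in> A0 \<and> a = g + \<epsilon> *\<^sub>R c)" for c a
    by (auto simp: op_add_def op_scale_def scaleR_scaleC)
  then have shift1: "(c, a) \<in> op_add A0 (op_scale (complex_of_real \<epsilon>) Id) \<longleftrightarrow>
      (\<exists>u. c = ?C u \<and> a = blend (\<lambda>u. u - ?C u) \<epsilon> u)" for c a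
    unfolding ex by (auto simp: blend_def)
  have "(c, a) \<in> op_add (op_scale (complex_of_real \<epsilon>) A0) Id \<longleftrightarrow>
      (\<exists>g. (c, g) \<in> A0 \<and> a = c + \<epsilon> *\<^sub>R g)" for c a
    by (auto simp: op_add_def op_scale_def scaleR_scaleC add.commute)
  then have shift2: "(c, a) \<in> op_add (op_scale (complex_of_real \<epsilon>) A0) Id \<longleftrightarrow>
      (\<exists>u. c = ?C u \<and> a = blend ?C \<epsilon> u)" for c a
    unfolding ex by (auto simp: blend_def)
  have inj: "u = u'" if "?C u = ?C u'" for u u'
    using single_valuedD[OF sv, of "?C u" "u - ?C u" "u' - ?C u'"]
      resolvent_mem[OF A0, of u] resolvent_mem[OF A0, of u'] that by simp
  have K1: "(a, b) \<in> op_comp (op_add A0 Id) ((op_add A0 (op_scale (complex_of_real \<epsilon>) Id))\<inverse>)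
      \<longleftrightarrow> a = blend (\<lambda>u. u - ?C u) \<epsilon> b" for a b
    unfolding op_comp_def relcomp_unfold by (auto simp: add_Id shift1 dest: inj)
  have K2: "(a, b) \<in> op_comp (op_add A0 Id) ((op_add (op_scale (complex_of_real \<epsilon>) A0) Id)\<inverse>)
      \<longleftrightarrow> a = blend ?C \<epsilon> b" for a b
    unfolding op_comp_def relcomp_unfold by (auto simp: add_Id shift2 dest: inj)
  have restrict: "(op_restrict (op_comp (orth_projector N) K) N)\<inverse> = compressed_inverse N S"
    if K: "\<And>a b. (a, b) \<in> K \<longleftrightarrow> a = S b" for K S
    by (auto simp: op_restrict_def op_comp_def[of "orth_projector N"] relcomp_unfold K P
        compressed_inverse_def)
  show "?L1 = ?R1" by (rule restrict) (rule K1)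
  show "?L2 = ?R2" by (rule restrict) (rule K2)
qed

section \<open>The uniqueness criterion\<close>

text \<open>Passing to \<open>(B + I)\<inverse>\<close> is injective, and an operator extends \<open>A\<close> precisely if \<open>(B + I)\<inverse>\<close> sends
  \<open>f + g\<close> to \<open>f\<close> for all \<open>(f, g) \<in> A\<close>, that is, if it agrees with \<open>(A0 + I)\<inverse>\<close> on the range of \<open>A + I\<close>.\<close>

lemma unique_extension_iff:
  fixes A A0 :: "'a::chilbert_space op"
  assumes "densely_defined A" and A0: "nonneg_sa_extension A A0"
  shows "(\<forall>B. nonneg_sa_extension A B \<longrightarrow> B = A0) \<longleftrightarrow>
    (\<forall>D. positive_contraction D \<longrightarrow> (\<forall>m\<in>shifted_range A. D m = resolvent A0 m) \<longrightarrow> D = resolvent A0)"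
proof -
  have on_A: "resolvent B (f + g) = f" if "nonneg_sa_extension A B" "(f, g) \<in> A" for B f g
    using that by (auto simp: nonneg_sa_extension_def selfadjoint_op_def intro: resolvent_eqI)
  show ?thesis
  proof (intro iffI allI impI)
    fix D assume unique: "\<forall>B. nonneg_sa_extension A B \<longrightarrow> B = A0" and D: "positive_contraction D"
      and agree: "\<forall>m\<in>shifted_range A. D m = resolvent A0 m"
    have "D (f + g) = f" if "(f, g) \<in> A" for f g
      using agree on_A[OF A0 that] shifted_rangeI[OF that] by simp
    then obtain B where "nonneg_sa_extension A B" "resolvent B = D"
      using extension_from_positive_contraction[OF D assms(1)] by metis
    then show "D = resolvent A0" using unique by blast
  next
    fix B assume unique: "\<forall>D. positive_contraction D \<longrightarrow>
        (\<forall>m\<in>shifted_range A. D m = resolvent A0 m) \<longrightarrow> D = resolvent A0"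
      and B: "nonneg_sa_extension A B"
    have "resolvent B m = resolvent A0 m" if "m \<in> shifted_range A" for m
      using that on_A[OF A0] on_A[OF B] by (auto simp: shifted_range_def)
    moreover have "positive_contraction (resolvent B)"
      using B by (simp add: nonneg_sa_extension_def positive_contraction_resolvent)
    ultimately have "resolvent B = resolvent A0"
      using unique by blast
    then have "(f, g) \<in> B \<longleftrightarrow> (f, g) \<in> A0" for f g
      using mem_iff_resolvent[of B f g] mem_iff_resolvent[of A0 f g] A0 B
      by (simp add: nonneg_sa_extension_def)
    then show "B = A0" by auto
  qed
qed

theorem theorem3p1:
  fixes A A0 P :: "'a::chilbert_space op" and N :: "'a set"
  assumes separable: "separable_space (euclidean :: 'a topology)"
    and A: "symmetric_op A" "densely_defined A" "closed A" "nonnegative_op A"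
    and A0: "nonneg_sa_extension A A0"
  defines "N \<equiv> defect_subspace A (-1)"
    and "P \<equiv> orth_projector N"
  shows "(\<forall>B. nonneg_sa_extension A B \<longrightarrow> B = A0) \<longleftrightarrow>
    strong_limit_in N
      (\<lambda>\<epsilon>::real. (op_restrict (op_comp P (op_comp (op_add A0 Id)
         ((op_add A0 (op_scale (complex_of_real \<epsilon>) Id))\<inverse>))) N)\<inverse>)
      (zero_op_in N) (at_right 0)
    \<and> strong_limit_in N
      (\<lambda>\<epsilon>::real. (op_restrict (op_comp P (op_comp (op_add A0 Id)
         ((op_add (op_scale (complex_of_real \<epsilon>) A0) Id)\<inverse>))) N)\<inverse>)
      (zero_op_in N) (at_right 0)"
proof -
  define M where "M = shifted_range A"
  have N: "N = orth_compl M"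
    by (simp add: N_def M_def defect_subspace_eq_orth_compl)
  have M: "csubspace M" "closed M"
    using A csubspace_shifted_range closed_shifted_range
    by (auto simp: M_def symmetric_op_def)
  have sa: "selfadjoint_op A0" "nonnegative_op A0"
    using A0 by (simp_all add: nonneg_sa_extension_def)
  note C = positive_contraction_resolvent[OF sa]
  show ?thesis
    unfolding P_def compressed_inverse_of_resolvent[OF sa] N
      compressed_inverse_limit_zero_iff[OF positive_contraction_complement[OF C] M]
      compressed_inverse_limit_zero_iff[OF C M]
      unique_extension_iff[OF A(2) A0] unique_positive_contraction_iff[OF C M, unfolded M_def]
    by (auto simp: M_def)
qed

end
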